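(* Let $F$ be a CNF propositional formula over variables $z_1,\ldots,z_n$ with set of satisfying assignments $R_F\subseteq\{0,1\}^n$, and let $0<\varepsilon\le1$ and $0<\delta\le1$. Suppose $\mathsf{ApproxMC}(F,\varepsilon,\delta)$ returns $c$. Then $$\Pr\left[(1+\varepsilon)^{-1}|R_F|\le c\le(1+\varepsilon)|R_F|\right]\ \ge\ 1-\delta.$$
   Context: Hash family: for positive integers $n,m$, $H_{xor}(n,m,3)$ is the family of functions $h:\{0,1\}^n\to\{0,1\}^m$ of the form $h(y)[j]=a_{j,0}\oplus\bigoplus_{k=1}^n a_{j,k}\cdot y[k]$ for $1\le j\le m$, with $a_{j,k}\in\{0,1\}$; a random $h$ is chosen by picking all $a_{j,k}$ independently and uniformly at random. $\mathsf{BoundedSAT}(F',v)$, for a formula $F'$ (a CNF formula conjoined with xor constraints) and integer $v\ge0$, returns a set of $\min(v,\#F')$ satisfying assignments of $F'$, where $\#F'$ is the number of satisfying assignments. $\mathsf{ApproxMCCore}(F,\mathit{pivot})$: let $S\leftarrow\mathsf{BoundedSAT}(F,\mathit{pivot}+1)$; if $|S|\le\mathit{pivot}$, return $|S|$. Otherwise set $l\leftarrow\lfloor\log_2\mathit{pivot}\rfloor-1$ and $i\leftarrow l-1$, and repeat: $i\leftarrow i+1$; choose $h$ uniformly at random from $H_{xor}(n,i-l,3)$; choose $\alpha$ uniformly at random from $\{0,1\}^{i-l}$ (all choices independent of previous ones); $S\leftarrow\mathsf{BoundedSAT}(F\wedge(h(z_1,\ldots,z_n)=\alpha),\mathit{pivot}+1)$;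 until $1\le|S|\le\mathit{pivot}$ or $i=n$. Then if $|S|>\mathit{pivot}$ or $|S|=0$ return $\bot$, else return $|S|\cdot 2^{i-l}$. $\mathsf{ApproxMC}(F,\varepsilon,\delta)$ sets $\mathit{pivot}=2\lceil 3e^{1/2}(1+1/\varepsilon)^2\rceil$ and $t=\lceil 35\log_2(3/\delta)\rceil$, runs $\mathsf{ApproxMCCore}(F,\mathit{pivot})$ $t$ times independently, and returns the median of the non-$\bot$ values returned ($\bot$ if there are none). *)

theory Defs
  imports "HOL-Probability.Probability" "HOL-Library.Z2"
begin

text \<open>
  The two-element field \<^typ>\<open>bit\<close> is \<open>{0,1}\<close> with exclusive or as addition.
  Vectors are indexed from 1.
\<close>

definition cube :: "nat \<Rightarrow> (nat \<Rightarrow> bit) set" where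
  "cube n = {1..n} \<rightarrow>\<^sub>E UNIV"

datatype literal = PosLit nat | NegLit nat

fun lit_var :: "literal \<Rightarrow> nat" where
  "lit_var (PosLit v) = v"
| "lit_var (NegLit v) = v"

fun lit_holds :: "(nat \<Rightarrow> bit) \<Rightarrow> literal \<Rightarrow> bool" where
  "lit_holds y (PosLit v) \<longleftrightarrow> y v = 1"
| "lit_holds y (NegLit v) \<longleftrightarrow> y v = 0"

type_synonym clause = "literal list"
type_synonym cnf = "clause list"

definition cnf_over :: "nat \<Rightarrow> cnf \<Rightarrow> bool" where
  "cnf_over n F \<longleftrightarrow> (\<forall>C\<in>set F. \<forall>L\<in>set C. lit_var L \<in> {1..n})"

definition cnf_holds :: "(nat \<Rightarrow> bit) \<Rightarrow> cnf \<Rightarrow> bool" where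
  "cnf_holds y F \<longleftrightarrow> (\<forall>C\<in>set F. \<exists>L\<in>set C. lit_holds y L)"

definition cnf_sols :: "nat \<Rightarrow> cnf \<Rightarrow> (nat \<Rightarrow> bit) set" where
  "cnf_sols n F = {y \<in> cube n. cnf_holds y F}"

definition xor_value :: "nat \<Rightarrow> (nat \<Rightarrow> bit) \<Rightarrow> (nat \<Rightarrow> bit) \<Rightarrow> bit" where
  "xor_value n a y = a 0 + (\<Sum>k=1..n. a k * y k)"

text \<open>
  \<open>XorEq a b\<close> is the constraint \<open>a 0 \<oplus> a 1 \<cdot> z\<^sub>1 \<oplus> \<dots> \<oplus> a n \<cdot> z\<^sub>n = b\<close>.
\<close>

datatype xor_constraint = XorEq "nat \<Rightarrow> bit" bit

fun xor_holds :: "nat \<Rightarrow> (nat \<Rightarrow> bit) \<Rightarrow> xor_constraint \<Rightarrow> bool" where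
  "xor_holds n y (XorEq a b) \<longleftrightarrow> xor_value n a y = b"

datatype cnf_xor = CnfXor cnf "xor_constraint list"

fun sols :: "nat \<Rightarrow> cnf_xor \<Rightarrow> (nat \<Rightarrow> bit) set" where
  "sols n (CnfXor F Xs) = {y \<in> cube n. cnf_holds y F \<and> (\<forall>X\<in>set Xs. xor_holds n y X)}"

text \<open>
  A member of the family is represented by its coefficients \<open>a (j, k)\<close>,
  \<open>1 \<le> j \<le> m\<close>, \<open>0 \<le> k \<le> n\<close>; the function it stands for is \<open>hxor n m a\<close>.
\<close>

definition hxor :: "nat \<Rightarrow> nat \<Rightarrow> (nat \<times> nat \<Rightarrow> bit) \<Rightarrow> (nat \<Rightarrow> bit) \<Rightarrow> (nat \<Rightarrow> bit)" where
  "hxor n m a y = (\<lambda>j\<in>{1..m}. xor_value n (\<lambda>k. a (j, k)) y)"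

definition random_hxor :: "nat \<Rightarrow> nat \<Rightarrow> (nat \<times> nat \<Rightarrow> bit) pmf" where
  "random_hxor n m = Pi_pmf ({1..m} \<times> {0..n}) 0 (\<lambda>_. pmf_of_set UNIV)"

definition conj_hash :: "cnf \<Rightarrow> nat \<Rightarrow> (nat \<times> nat \<Rightarrow> bit) \<Rightarrow> (nat \<Rightarrow> bit) \<Rightarrow> cnf_xor" where
  "conj_hash F m a \<alpha> = CnfXor F (map (\<lambda>j. XorEq (\<lambda>k. a (j, k)) (\<alpha> j)) [1..<Suc m])"

lemma sols_conj_hash:
  assumes "\<alpha> \<in> cube m"
  shows "sols n (conj_hash F m a \<alpha>) = {y \<in> cnf_sols n F. hxor n m a y = \<alpha>}"
proof -
  have "hxor n m a y = \<alpha> \<longleftrightarrow> (\<forall>j\<in>{1..m}. xor_value n (\<lambda>k. a (j, k)) y = \<alpha> j)" for y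
    using assms unfolding hxor_def cube_def
    by (auto simp: fun_eq_iff PiE_def extensional_def)
  then show ?thesis
    by (auto simp: conj_hash_def cnf_sols_def)
qed

text \<open>
  Which solutions the solver returns is left open: any function meeting the
  specification is admitted.
\<close>

type_synonym solver = "cnf_xor \<Rightarrow> nat \<Rightarrow> (nat \<Rightarrow> bit) set"

definition bounded_sat :: "nat \<Rightarrow> solver \<Rightarrow> bool" where
  "bounded_sat n B \<longleftrightarrow>
     (\<forall>F Xs v. cnf_over n F \<longrightarrow>
        B (CnfXor F Xs) v \<subseteq> sols n (CnfXor F Xs) \<and>
        card (B (CnfXor F Xs) v) = min v (card (sols n (CnfXor F Xs))))"

lemma ex_bounded_sat: "\<exists>B. bounded_sat n B"
proof -
  have "\<exists>S. S \<subseteq> sols n G \<and> card S = min v (card (sols n G))" for G v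
    by (meson min.cobounded2 obtain_subset_with_card_n)
  then show ?thesis
    unfolding bounded_sat_def by metis
qed

text \<open>
  The result \<open>\<bottom>\<close> is \<^const>\<open>None\<close>.  The loop is entered with \<open>i = l\<close>.
  When it is reached, \<open>F\<close> has more than \<open>pivot\<close> solutions, so \<open>l < n\<close> and the exit
  test \<open>n \<le> i\<close> amounts to \<open>i = n\<close>; stated this way it makes the recursion total.
\<close>

function core_loop ::
  "solver \<Rightarrow> nat \<Rightarrow> cnf \<Rightarrow> nat \<Rightarrow> nat \<Rightarrow> nat \<Rightarrow> nat option pmf" where
  "core_loop B n F pivot l i =
     do {
       a \<leftarrow> random_hxor n (i - l);
       \<alpha> \<leftarrow> pmf_of_set (cube (i - l));
       let s = card (B (conj_hash F (i - l) a \<alpha>) (pivot + 1));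
       if (1 \<le> s \<and> s \<le> pivot) \<or> n \<le> i
       then return_pmf (if s > pivot \<or> s = 0 then None else Some (s * 2 ^ (i - l)))
       else core_loop B n F pivot l (i + 1)
     }"
  by pat_completeness auto
termination
  by (relation "Wellfounded.measure (\<lambda>(B, n, F, pivot, l, i). n - i)") auto

declare core_loop.simps [simp del]

definition approxmc_core :: "solver \<Rightarrow> nat \<Rightarrow> cnf \<Rightarrow> nat \<Rightarrow> nat option pmf" where
  "approxmc_core B n F pivot =
     (let s = card (B (CnfXor F []) (pivot + 1)) in
      if s \<le> pivot then return_pmf (Some s)
      else let l = nat (\<lfloor>log 2 (real pivot)\<rfloor> - 1) in core_loop B n F pivot l l)"

text \<open>For an even number of values the median is the mean of the two middle ones.\<close>

definition median :: "real list \<Rightarrow> real" where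
  "median xs =
     (let ys = sort xs; k = length ys in
      if odd k then ys ! (k div 2) else (ys ! (k div 2 - 1) + ys ! (k div 2)) / 2)"

definition median_non_bot :: "nat option list \<Rightarrow> real option" where
  "median_non_bot rs =
     (let cs = map (\<lambda>r. real (the r)) (filter (\<lambda>r. r \<noteq> None) rs) in
      if cs = [] then None else Some (median cs))"

definition approxmc_pivot :: "real \<Rightarrow> nat" where
  "approxmc_pivot \<epsilon> = 2 * nat \<lceil>3 * exp (1 / 2) * (1 + 1 / \<epsilon>)\<^sup>2\<rceil>"

definition approxmc_reps :: "real \<Rightarrow> nat" where
  "approxmc_reps \<delta> = nat \<lceil>35 * log 2 (3 / \<delta>)\<rceil>"

definition approxmc :: "solver \<Rightarrow> nat \<Rightarrow> cnf \<Rightarrow> real \<Rightarrow> real \<Rightarrow> real option pmf" where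
  "approxmc B n F \<epsilon> \<delta> =
     map_pmf median_non_bot
       (replicate_pmf (approxmc_reps \<delta>) (approxmc_core B n F (approxmc_pivot \<epsilon>)))"

end

theory Submission
  imports Defs
begin

text \<open>
  With \<open>m\<close> random affine constraints the number \<open>S\<close> of surviving solutions has mean
  \<open>\<mu>\<^sub>m = |R\<^sub>F| / 2\<^sup>m\<close> and, by pairwise independence of the hash values, variance at most \<open>\<mu>\<^sub>m\<close>.
  Put \<open>K = pivot / 2\<close>, \<open>\<beta> = \<epsilon> / (1 + \<epsilon>)\<close>, and let \<open>M\<close> be the first \<open>m\<close> with \<open>\<mu>\<^sub>m \<le> K\<close>, so that
  \<open>\<mu>\<^sub>M = x K\<close> with \<open>1/2 < x \<le> 1\<close>.  A run fails only if it stops at some \<open>m < M\<close> with an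
  off-target count, or reaches \<open>M\<close> and is off target there.  Since \<open>\<beta>\<^sup>2 K \<ge> 3 \<surd>e\<close>, Chebyshev's
  inequality bounds the off-target probability at \<open>M\<close>, \<open>M - 1\<close> and \<open>M - 2\<close> by \<open>q/x\<close>, \<open>q/(2x)\<close>,
  \<open>q/(4x)\<close> with \<open>q = 1 / (\<beta>\<^sup>2 K)\<close>; for smaller \<open>m\<close> stopping requires \<open>S \<le> 2K\<close>, far below \<open>\<mu>\<^sub>m\<close>, and
  these probabilities form a geometric series.  Cantelli's inequality bounds the probability of
  going from \<open>M - 1\<close> on to \<open>M\<close> by \<open>x / (x + 40 (1 - x)\<^sup>2)\<close>, which suffices to keep the total failure
  probability of a run below \<open>0.4\<close>.  By Hoeffding's inequality, more than half of the \<open>t\<close> runs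
  succeed, and hence so does the median, except with probability at most \<open>exp (- t / 50) \<le> \<delta>\<close>.
\<close>

text \<open>As simp rules these turn field arithmetic in \<open>bit\<close> into Boolean case distinctions.\<close>

declare add_bit_eq_xor [simp del] mult_bit_eq_and [simp del]

section \<open>Probabilities of mixtures, and the Chebyshev and Cantelli bounds\<close>

lemma prob_bind_pmf:
  "measure_pmf.prob (bind_pmf M f) A = measure_pmf.expectation M (\<lambda>x. measure_pmf.prob (f x) A)"
proof -
  have int: "integrable (measure_pmf M) (\<lambda>x. measure_pmf.prob (f x) A)"
    by (rule measure_pmf.integrable_const_bound[where B = 1]) auto
  have "ennreal (measure_pmf.prob (bind_pmf M f) A) = (\<integral>\<^sup>+x. emeasure (f x) A \<partial>M)"
    by (simp flip: measure_pmf.emeasure_eq_measure)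
  also have "\<dots> = (\<integral>\<^sup>+x. ennreal (measure_pmf.prob (f x) A) \<partial>M)"
    by (simp add: measure_pmf.emeasure_eq_measure)
  also have "\<dots> = ennreal (measure_pmf.expectation M (\<lambda>x. measure_pmf.prob (f x) A))"
    by (rule nn_integral_eq_integral[OF int]) auto
  finally show ?thesis
    by (subst (asm) ennreal_inj) auto
qed

lemma prob_bind_pmf_le:
  assumes "\<And>x. x \<in> set_pmf M \<Longrightarrow> measure_pmf.prob (f x) A \<le> c"
  shows "measure_pmf.prob (bind_pmf M f) A \<le> c"
proof -
  have int: "integrable (measure_pmf M) (\<lambda>x. measure_pmf.prob (f x) A)"
    by (rule measure_pmf.integrable_const_bound[where B = 1]) auto
  show ?thesis
    unfolding prob_bind_pmf
    by (rule measure_pmf.integral_le_const[OF int]) (auto simp: AE_measure_pmf_iff assms)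
qed

lemma prob_le_expectation:
  fixes g :: "'a \<Rightarrow> real"
  assumes "finite (set_pmf M)" "\<And>x. g x \<ge> 0" "\<And>x. x \<in> A \<Longrightarrow> g x \<ge> 1"
  shows "measure_pmf.prob M A \<le> measure_pmf.expectation M g"
proof -
  have "measure_pmf.prob M A = measure_pmf.expectation M (indicator A)"
    by simp
  also have "\<dots> \<le> measure_pmf.expectation M g"
    using assms by (intro integral_mono) (auto intro!: integrable_measure_pmf_finite split: split_indicator)
  finally show ?thesis .
qed

text \<open>The mean is exact, while \<open>v\<close> is only an upper bound for the variance.
  Finite support makes every function integrable.\<close>

definition mean_var_le :: "nat pmf \<Rightarrow> real \<Rightarrow> real \<Rightarrow> bool" where
  "mean_var_le M \<mu> v \<longleftrightarrow> finite (set_pmf M) \<and> measure_pmf.expectation M real = \<mu> \<and>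
     measure_pmf.expectation M (\<lambda>x. (real x - \<mu>)\<^sup>2) \<le> v"

lemma chebyshev:
  assumes "mean_var_le M \<mu> v" "a > 0" "\<And>x. x \<in> A \<Longrightarrow> a \<le> \<bar>real x - \<mu>\<bar>"
  shows "measure_pmf.prob M A \<le> v / a\<^sup>2"
proof -
  have "measure_pmf.prob M A \<le> measure_pmf.expectation M (\<lambda>x. (real x - \<mu>)\<^sup>2 / a\<^sup>2)"
  proof (rule prob_le_expectation)
    fix x assume "x \<in> A"
    then have "a\<^sup>2 \<le> (real x - \<mu>)\<^sup>2"
      using assms by (simp add: abs_le_square_iff[symmetric])
    then show "1 \<le> (real x - \<mu>)\<^sup>2 / a\<^sup>2"
      using assms(2) by simp
  qed (use assms in \<open>auto simp: mean_var_le_def\<close>)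
  also have "\<dots> = measure_pmf.expectation M (\<lambda>x. (real x - \<mu>)\<^sup>2) / a\<^sup>2"
    by simp
  also have "\<dots> \<le> v / a\<^sup>2"
    using assms by (intro divide_right_mono) (auto simp: mean_var_le_def)
  finally show ?thesis .
qed

lemma cantelli:
  assumes "mean_var_le M \<mu> v" "v > 0" "a \<ge> 0" "\<And>x. x \<in> A \<Longrightarrow> a \<le> real x - \<mu>"
  shows "measure_pmf.prob M A \<le> v / (v + a\<^sup>2)"
proof (cases "a = 0")
  case False
  with assms have a: "a > 0" by simp
  \<comment> \<open>This shift minimizes \<open>(v + u\<^sup>2) / (a + u)\<^sup>2\<close>, the bound
    that Markov's inequality yields for \<open>(real x - \<mu> + u)\<^sup>2\<close>.\<close>
  define u where "u = v / a"
  have u: "u > 0" using a assms(2) by (simp add: u_def)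
  have fin: "finite (set_pmf M)" and mean: "measure_pmf.expectation M real = \<mu>"
    using assms(1) by (auto simp: mean_var_le_def)
  note int = integrable_measure_pmf_finite[OF fin]
  have "measure_pmf.prob M A \<le> measure_pmf.expectation M (\<lambda>x. (real x - \<mu> + u)\<^sup>2 / (a + u)\<^sup>2)"
  proof (rule prob_le_expectation)
    fix x assume "x \<in> A"
    then have "(a + u)\<^sup>2 \<le> (real x - \<mu> + u)\<^sup>2"
      using assms u by (intro power_mono) auto
    then show "1 \<le> (real x - \<mu> + u)\<^sup>2 / (a + u)\<^sup>2"
      using a u by simp
  qed (use fin in auto)
  also have "\<dots> = measure_pmf.expectation M (\<lambda>x. (real x - \<mu> + u)\<^sup>2) / (a + u)\<^sup>2"
    by simp
  also have "measure_pmf.expectation M (\<lambda>x. (real x - \<mu> + u)\<^sup>2) =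
      measure_pmf.expectation M (\<lambda>x. (real x - \<mu>)\<^sup>2 + (2 * u * (real x - \<mu>) + u\<^sup>2))"
    by (intro Bochner_Integration.integral_cong) (auto simp: power2_eq_square algebra_simps)
  also have "\<dots> = measure_pmf.expectation M (\<lambda>x. (real x - \<mu>)\<^sup>2) +
      (2 * u * (measure_pmf.expectation M real - \<mu>) + u\<^sup>2)"
    by (simp add: int)
  also have "\<dots> \<le> v + u\<^sup>2"
    using assms(1) by (simp add: mean mean_var_le_def)
  finally have "measure_pmf.prob M A \<le> (v + u\<^sup>2) / (a + u)\<^sup>2"
    by (simp add: divide_right_mono)
  also have "\<dots> = v / (v + a\<^sup>2)"
  proof -
    define w where "w = v + a\<^sup>2"
    have "w > 0" using assms(2) by (simp add: w_def add_pos_nonneg)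
    moreover have "v + u\<^sup>2 = v * w / a\<^sup>2" "a + u = w / a"
      using a by (simp_all add: w_def u_def field_simps power2_eq_square)
    ultimately show ?thesis
      unfolding w_def[symmetric] using a by (simp add: power2_eq_square)
  qed
  finally show ?thesis .
qed (use assms in simp)

text \<open>The second moment is a sum over pairs \<open>(y, y')\<close>. Pairwise independence
  gives \<open>p\<^sup>2\<close> off the diagonal; granting \<open>p\<^sup>2 + p\<close> on it makes
  the sum \<open>\<mu>\<^sup>2 + \<mu>\<close>.\<close>

lemma mean_var_le_count:
  fixes Q :: "'b \<Rightarrow> 'a \<Rightarrow> bool"
  assumes fin: "finite (set_pmf M)" and R: "finite R"
    and p1: "\<And>y. y \<in> R \<Longrightarrow> measure_pmf.prob M {x. Q y x} = p"
    and p2: "\<And>y y'. y \<in> R \<Longrightarrow> y' \<in> R \<Longrightarrow> y \<noteq> y' \<Longrightarrow> measure_pmf.prob M {x. Q y x \<and> Q y' x} = p\<^sup>2"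
  shows "mean_var_le (map_pmf (\<lambda>x. card {y \<in> R. Q y x}) M) (real (card R) * p) (real (card R) * p)"
proof -
  let ?E = "measure_pmf.expectation M"
  define \<mu> where "\<mu> = real (card R) * p"
  note int = integrable_measure_pmf_finite[OF fin]
  have card: "real (card {y \<in> R. Q y x}) = (\<Sum>y\<in>R. indicator {x. Q y x} x)" for x
  proof -
    have "(\<Sum>y\<in>R. indicator {x. Q y x} x) = (\<Sum>y\<in>R. if Q y x then 1 else 0 :: real)"
      by (intro sum.cong) auto
    also have "\<dots> = real (card {y \<in> R. Q y x})"
      using R by (simp add: sum.If_cases Int_def)
    finally show ?thesis by simp
  qed
  have mean: "?E (\<lambda>x. real (card {y \<in> R. Q y x})) = \<mu>"
    unfolding card by (simp add: int p1 \<mu>_def)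
  have sq: "(real (card {y \<in> R. Q y x}))\<^sup>2 =
      (\<Sum>y\<in>R. \<Sum>y'\<in>R. indicator {x. Q y x \<and> Q y' x} x)" for x
    unfolding card power2_eq_square sum_product
    by (intro sum.cong refl) (auto simp: indicator_def)
  have "?E (\<lambda>x. (real (card {y \<in> R. Q y x}))\<^sup>2) =
      (\<Sum>y\<in>R. \<Sum>y'\<in>R. measure_pmf.prob M {x. Q y x \<and> Q y' x})"
    unfolding sq by (simp add: int)
  also have "\<dots> \<le> (\<Sum>y\<in>R. \<Sum>y'\<in>R. p\<^sup>2 + (if y' = y then p else 0))"
  proof (intro sum_mono)
    fix y y' assume "y \<in> R" "y' \<in> R"
    then show "measure_pmf.prob M {x. Q y x \<and> Q y' x} \<le> p\<^sup>2 + (if y' = y then p else 0)"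
      using p1[of y] p2[of y y'] by auto
  qed
  also have "\<dots> = \<mu>\<^sup>2 + \<mu>"
    using R by (simp add: sum.distrib \<mu>_def power2_eq_square algebra_simps)
  finally have sq_le: "?E (\<lambda>x. (real (card {y \<in> R. Q y x}))\<^sup>2) \<le> \<mu>\<^sup>2 + \<mu>" .
  have "?E (\<lambda>x. (real (card {y \<in> R. Q y x}) - \<mu>)\<^sup>2) =
     ?E (\<lambda>x. (real (card {y \<in> R. Q y x}))\<^sup>2 - (2 * \<mu> * real (card {y \<in> R. Q y x}) - \<mu>\<^sup>2))"
    by (intro Bochner_Integration.integral_cong) (auto simp: power2_eq_square algebra_simps)
  also have "\<dots> = ?E (\<lambda>x. (real (card {y \<in> R. Q y x}))\<^sup>2) - (2 * \<mu> * \<mu> - \<mu>\<^sup>2)"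
    by (simp add: int mean)
  also have "\<dots> \<le> \<mu>"
    using sq_le by (simp add: power2_eq_square)
  finally show ?thesis
    using mean fin by (simp add: mean_var_le_def \<mu>_def)
qed

text \<open>Each \<open>g\<close> embeds the fibre of \<open>\<Phi>\<close> over \<open>u\<close>
  into the fibre over \<open>v\<close>. By symmetry all fibres over \<open>T\<close> have the same
  size.\<close>

lemma prob_uniform_of_translation:
  assumes A: "finite A" "A \<noteq> {}" and T: "finite T" and maps: "\<And>a. a \<in> A \<Longrightarrow> \<Phi> a \<in> T"
    and tr: "\<And>u v. u \<in> T \<Longrightarrow> v \<in> T \<Longrightarrow>
      \<exists>g. inj_on g A \<and> g ` A \<subseteq> A \<and> (\<forall>a\<in>A. \<Phi> a = u \<longrightarrow> \<Phi> (g a) = v)"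
    and t: "t \<in> T"
  shows "measure_pmf.prob (pmf_of_set A) {a. \<Phi> a = t} = 1 / real (card T)"
proof -
  let ?S = "\<lambda>u. {a \<in> A. \<Phi> a = u}"
  have le: "card (?S u) \<le> card (?S v)" if uv: "u \<in> T" "v \<in> T" for u v
  proof -
    obtain g where "inj_on g A" "g ` A \<subseteq> A" "\<forall>a\<in>A. \<Phi> a = u \<longrightarrow> \<Phi> (g a) = v"
      using tr[OF uv] by blast
    then show ?thesis
      using A by (intro card_inj_on_le[where f = g]) (auto simp: inj_on_def)
  qed
  have "card A = card (\<Union>u\<in>T. ?S u)"
    using maps by (intro arg_cong[where f = card]) auto
  also have "\<dots> = (\<Sum>u\<in>T. card (?S u))"
    using A T by (intro card_UN_disjoint) auto
  also have "\<dots> = (\<Sum>u\<in>T. card (?S t))"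
    using t by (intro sum.cong refl antisym le)
  finally have *: "card A = card T * card (?S t)"
    by simp
  have "measure_pmf.prob (pmf_of_set A) {a. \<Phi> a = t} = real (card (?S t)) / real (card A)"
    using A by (simp add: measure_pmf_of_set Int_def)
  moreover have "card A \<noteq> 0" using A by simp
  ultimately show ?thesis
    using * by (auto simp: field_simps)
qed

section \<open>Pairwise independence of the xor hash family\<close>

lemma xor_value_add:
  "xor_value n (\<lambda>k. a k + b k) y = xor_value n a y + xor_value n b y"
  by (simp add: xor_value_def sum.distrib algebra_simps)

lemma UNIV_bit: "(UNIV :: bit set) = {0, 1}"
  using bit_not_one_iff by auto

lemma finite_UNIV_bit [simp]: "finite (UNIV :: bit set)"
  unfolding UNIV_bit by simp

lemma finite_cube [simp]: "finite (cube n)"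
  unfolding cube_def by (intro finite_PiE) auto

lemma card_cube: "card (cube n) = 2 ^ n"
  by (simp add: cube_def card_PiE UNIV_bit numeral_2_eq_2)

lemma cube_nonempty [simp]: "cube n \<noteq> {}"
  by (simp add: cube_def PiE_eq_empty_iff)

lemma hxor_in_cube: "hxor n m a y \<in> cube m"
  by (auto simp: hxor_def cube_def)

lemma bit_add_self [simp]: "(b::bit) + b = 0"
  by (cases b) auto

lemma bit_add_cancel_left: "(b::bit) + (b + c) = c"
  by (simp flip: add.assoc)

abbreviation coeffs_set :: "nat \<Rightarrow> nat \<Rightarrow> (nat \<times> nat \<Rightarrow> bit) set" where
  "coeffs_set n m \<equiv> PiE_dflt ({1..m} \<times> {0..n}) 0 (\<lambda>_. UNIV)"

lemma random_hxor_uniform: "random_hxor n m = pmf_of_set (coeffs_set n m)"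
  unfolding random_hxor_def by (rule Pi_pmf_of_set) auto

lemma finite_coeffs_set [simp]: "finite (coeffs_set n m)"
  by (rule finite_PiE_dflt) auto

lemma coeffs_set_translate:
  assumes "a0 \<in> coeffs_set n m"
  shows "inj_on (\<lambda>a x. a x + a0 x) A"
    and "(\<lambda>a x. a x + a0 x) ` coeffs_set n m \<subseteq> coeffs_set n m"
proof -
  show "inj_on (\<lambda>a x. a x + a0 x) A"
  proof (rule inj_onI)
    fix a b assume "(\<lambda>x. a x + a0 x) = (\<lambda>x. b x + a0 x)"
    then have "a x + a0 x = b x + a0 x" for x by meson
    then have "a x + a0 x + a0 x = b x + a0 x + a0 x" for x by simp
    then show "a = b" by (simp add: add.assoc fun_eq_iff)
  qed
qed (use assms in \<open>auto simp: PiE_dflt_def\<close>)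

text \<open>Rows with a constant term and a single further coefficient suffice to shift the hash
  values of two distinct points independently.\<close>

lemma xor_value_single:
  assumes "k \<in> {1..n}"
  shows "xor_value n (\<lambda>i. if i = 0 then c else if i = k then d else 0) y = c + d * y k"
proof -
  have "(\<Sum>i=1..n. (if i = 0 then c else if i = k then d else 0) * y i) =
        (\<Sum>i=1..n. if i = k then d * y k else 0)"
    using assms by (intro sum.cong) auto
  then show ?thesis using assms by (simp add: xor_value_def)
qed

text \<open>Hash values are additive in the coefficients, and adding \<open>u j + v j\<close> to
  \<open>u j\<close> gives \<open>v j\<close> in characteristic 2.\<close>

lemma hxor_translate:
  assumes "u \<in> cube m" "v \<in> cube m" "hxor n m a y = u"
    and "\<And>j. j \<in> {1..m} \<Longrightarrow> xor_value n (\<lambda>k. a0 (j, k)) y = u j + v j"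
  shows "hxor n m (\<lambda>x. a x + a0 x) y = v"
proof
  fix j
  show "hxor n m (\<lambda>x. a x + a0 x) y j = v j"
  proof (cases "j \<in> {1..m}")
    case True
    then have "xor_value n (\<lambda>k. a (j, k)) y = u j"
      using assms(3) by (auto simp: hxor_def)
    then show ?thesis
      using True assms(4) by (simp add: hxor_def xor_value_add bit_add_cancel_left)
  next
    case False
    then show ?thesis using assms(2)
      by (auto simp: hxor_def cube_def PiE_def extensional_def)
  qed
qed

lemma prob_hxor_eq:
  assumes "\<alpha> \<in> cube m"
  shows "measure_pmf.prob (random_hxor n m) {a. hxor n m a y = \<alpha>} = 1 / 2 ^ m"
proof -
  have "measure_pmf.prob (random_hxor n m) {a. hxor n m a y = \<alpha>} = 1 / real (card (cube m))"
    unfolding random_hxor_uniform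
  proof (rule prob_uniform_of_translation)
    fix u v :: "nat \<Rightarrow> bit" assume uv: "u \<in> cube m" "v \<in> cube m"
    \<comment> \<open>Changing only the constant term of row \<open>j\<close> shifts the hash value
      of every point by \<open>u j + v j\<close>.\<close>
    define a0 where "a0 = (\<lambda>(j, k :: nat). if j \<in> {1..m} \<and> k = 0 then u j + v j else 0)"
    have "a0 \<in> coeffs_set n m" by (auto simp: a0_def PiE_dflt_def)
    moreover have "xor_value n (\<lambda>k. a0 (j, k)) y = u j + v j" if "j \<in> {1..m}" for j
      using that by (simp add: a0_def xor_value_def)
    ultimately show "\<exists>g. inj_on g (coeffs_set n m) \<and> g ` coeffs_set n m \<subseteq> coeffs_set n m \<and>
        (\<forall>a\<in>coeffs_set n m. hxor n m a y = u \<longrightarrow> hxor n m (g a) y = v)"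
      using uv
      by (intro exI[of _ "\<lambda>a x. a x + a0 x"] conjI coeffs_set_translate) (auto intro: hxor_translate)
  qed (use assms in \<open>auto simp: hxor_in_cube\<close>)
  then show ?thesis by (simp add: card_cube)
qed

lemma prob_hxor_eq_pair:
  assumes "\<alpha> \<in> cube m" "y \<in> cube n" "y' \<in> cube n" "y \<noteq> y'"
  shows "measure_pmf.prob (random_hxor n m) {a. hxor n m a y = \<alpha> \<and> hxor n m a y' = \<alpha>} = (1 / 2 ^ m)\<^sup>2"
proof -
  obtain k where k: "k \<in> {1..n}" "y k \<noteq> y' k"
    using assms(2-4) by (metis PiE_ext cube_def)
  then have sum1: "y k + y' k = 1"
    by (cases "y k"; cases "y' k") auto
  have "measure_pmf.prob (random_hxor n m) {a. (hxor n m a y, hxor n m a y') = (\<alpha>, \<alpha>)} =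
      1 / real (card (cube m \<times> cube m))"
    unfolding random_hxor_uniform
  proof (rule prob_uniform_of_translation)
    fix u v :: "(nat \<Rightarrow> bit) \<times> (nat \<Rightarrow> bit)"
    assume uv: "u \<in> cube m \<times> cube m" "v \<in> cube m \<times> cube m"
    define c where "c = (\<lambda>j. fst u j + fst v j)"
    define d where "d = (\<lambda>j. snd u j + snd v j)"
    \<comment> \<open>Row \<open>j\<close> adds \<open>c j + (c j + d j) * (y k + z k)\<close> to
      the hash value of \<open>z\<close>. This is \<open>c j\<close> for \<open>z = y\<close> and,
      because \<open>y k + y' k = 1\<close>, it is \<open>d j\<close> for
      \<open>z = y'\<close>.\<close>
    define a0 where "a0 = (\<lambda>(j, i). if j \<in> {1..m} then
       (if i = 0 then c j + (c j + d j) * y k else if i = k then c j + d j else 0) else 0)"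
    have "a0 \<in> coeffs_set n m" using k by (auto simp: a0_def PiE_dflt_def)
    moreover have "xor_value n (\<lambda>i. a0 (j, i)) z = c j + (c j + d j) * (y k + z k)"
      if "j \<in> {1..m}" for j z
      using that by (simp add: a0_def xor_value_single[OF k(1)] algebra_simps)
    then have "xor_value n (\<lambda>i. a0 (j, i)) y = fst u j + fst v j"
       "xor_value n (\<lambda>i. a0 (j, i)) y' = snd u j + snd v j" if "j \<in> {1..m}" for j
      using that sum1 by (simp_all add: bit_add_cancel_left, simp_all add: c_def d_def)
    ultimately show "\<exists>g. inj_on g (coeffs_set n m) \<and> g ` coeffs_set n m \<subseteq> coeffs_set n m \<and>
        (\<forall>a\<in>coeffs_set n m. (hxor n m a y, hxor n m a y') = u \<longrightarrow>
           (hxor n m (g a) y, hxor n m (g a) y') = v)"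
      using uv
      by (intro exI[of _ "\<lambda>a x. a x + a0 x"] conjI coeffs_set_translate)
        (cases u; cases v; auto intro: hxor_translate)+
  qed (use assms in \<open>auto simp: hxor_in_cube\<close>)
  then show ?thesis by (simp add: card_cube card_cartesian_product power2_eq_square)
qed

section \<open>Moments and tails of the number of surviving solutions\<close>

lemma finite_cnf_sols [simp]: "finite (cnf_sols n F)"
  by (auto simp: cnf_sols_def)

lemma card_cnf_sols_le: "card (cnf_sols n F) \<le> 2 ^ n"
  unfolding card_cube[symmetric] by (rule card_mono) (auto simp: cnf_sols_def)

lemma mean_var_le_hash_count:
  assumes "\<alpha> \<in> cube m"
  shows "mean_var_le (map_pmf (\<lambda>a. card {y \<in> cnf_sols n F. hxor n m a y = \<alpha>}) (random_hxor n m))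
     (real (card (cnf_sols n F)) / 2 ^ m) (real (card (cnf_sols n F)) / 2 ^ m)"
proof -
  have "finite (set_pmf (random_hxor n m))"
    unfolding random_hxor_uniform by (subst set_pmf_of_set) auto
  from mean_var_le_count[OF this finite_cnf_sols, of n F "\<lambda>y a. hxor n m a y = \<alpha>" "1 / 2 ^ m"]
  show ?thesis
    using assms by (simp add: prob_hxor_eq prob_hxor_eq_pair cnf_sols_def)
qed

text \<open>The number of solutions surviving \<open>m\<close> random constraints, without the
  cutoff of the solver. Drawing \<open>\<alpha>\<close> first lets the tail bounds be proved for
  each fixed \<open>\<alpha>\<close> and then averaged.\<close>

definition hash_count :: "nat \<Rightarrow> cnf \<Rightarrow> nat \<Rightarrow> nat pmf" where
  "hash_count n F m = pmf_of_set (cube m) \<bind>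
     (\<lambda>\<alpha>. map_pmf (\<lambda>a. card {y \<in> cnf_sols n F. hxor n m a y = \<alpha>}) (random_hxor n m))"

lemma hash_count_chebyshev:
  fixes \<mu> :: real
  assumes "\<mu> = real (card (cnf_sols n F)) / 2 ^ m" "a > 0"
    and "\<And>s. s \<in> A \<Longrightarrow> a \<le> \<bar>real s - \<mu>\<bar>"
  shows "measure_pmf.prob (hash_count n F m) A \<le> \<mu> / a\<^sup>2"
  unfolding hash_count_def
  using assms by (intro prob_bind_pmf_le chebyshev[where \<mu> = \<mu>]) (auto intro!: mean_var_le_hash_count)

lemma hash_count_cantelli:
  fixes \<mu> :: real
  assumes "\<mu> = real (card (cnf_sols n F)) / 2 ^ m" "\<mu> > 0" "a \<ge> 0"
    and "\<And>s. s \<in> A \<Longrightarrow> a \<le> real s - \<mu>"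
  shows "measure_pmf.prob (hash_count n F m) A \<le> \<mu> / (\<mu> + a\<^sup>2)"
  unfolding hash_count_def
  using assms by (intro prob_bind_pmf_le cantelli[where \<mu> = \<mu>]) (auto intro!: mean_var_le_hash_count)

lemma card_bounded_sat_conj_hash:
  assumes "cnf_over n F" "bounded_sat n B" "\<alpha> \<in> cube m"
  shows "card (B (conj_hash F m a \<alpha>) v) = min v (card {y \<in> cnf_sols n F. hxor n m a y = \<alpha>})"
  using assms sols_conj_hash[OF assms(3), of n F a]
  by (simp add: bounded_sat_def conj_hash_def)

text \<open>The loop body uses the solver's answer only through its size, and replacing a count
  above \<open>pivot\<close> by \<open>pivot + 1\<close> changes no test and no result.\<close>

lemma core_loop_hash_count:
  assumes "cnf_over n F" "bounded_sat n B"
  shows "core_loop B n F pivot l i = hash_count n F (i - l) \<bind> (\<lambda>s.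
      if (1 \<le> s \<and> s \<le> pivot) \<or> n \<le> i
      then return_pmf (if s > pivot \<or> s = 0 then None else Some (s * 2 ^ (i - l)))
      else core_loop B n F pivot l (i + 1))"
proof -
  define f where "f = (\<lambda>s. if (1 \<le> s \<and> s \<le> pivot) \<or> n \<le> i
      then return_pmf (if s > pivot \<or> s = 0 then None else Some (s * 2 ^ (i - l)))
      else core_loop B n F pivot l (i + 1))"
  have f_min: "f (min (Suc pivot) s) = f s" for s
    by (auto simp: f_def min_def not_le)
  have "core_loop B n F pivot l i = random_hxor n (i - l) \<bind> (\<lambda>a. pmf_of_set (cube (i - l)) \<bind>
      (\<lambda>\<alpha>. f (card (B (conj_hash F (i - l) a \<alpha>) (pivot + 1)))))"
    by (subst core_loop.simps) (simp add: f_def Let_def)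
  also have "\<dots> = pmf_of_set (cube (i - l)) \<bind> (\<lambda>\<alpha>. random_hxor n (i - l) \<bind>
      (\<lambda>a. f (card (B (conj_hash F (i - l) a \<alpha>) (pivot + 1)))))"
    by (rule bind_commute_pmf)
  also have "\<dots> = pmf_of_set (cube (i - l)) \<bind> (\<lambda>\<alpha>. random_hxor n (i - l) \<bind>
      (\<lambda>a. f (card {y \<in> cnf_sols n F. hxor n (i - l) a y = \<alpha>})))"
    by (intro bind_pmf_cong refl) (simp add: card_bounded_sat_conj_hash[OF assms] f_min)
  also have "\<dots> = hash_count n F (i - l) \<bind> f"
    by (simp add: hash_count_def bind_assoc_pmf bind_map_pmf)
  finally show ?thesis by (simp add: f_def)
qed

text \<open>Outcomes in \<open>C\<close> are charged as failures outright, those in \<open>N\<close>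
  lead to a stage failing with probability at most \<open>p\<close>, and all others succeed.\<close>

lemma prob_bind_pmf_le_split:
  assumes "\<And>s. s \<notin> C \<Longrightarrow> s \<in> N \<Longrightarrow> measure_pmf.prob (f s) A \<le> p"
    and "\<And>s. s \<notin> C \<Longrightarrow> s \<notin> N \<Longrightarrow> measure_pmf.prob (f s) A = 0" and "p \<ge> 0"
  shows "measure_pmf.prob (bind_pmf M f) A \<le> measure_pmf.prob M C + measure_pmf.prob M N * p"
proof -
  have int: "integrable (measure_pmf M) (indicator S :: 'a \<Rightarrow> real)" for S
    by (rule measure_pmf.integrable_const_bound[where B = 1]) auto
  have "measure_pmf.prob (bind_pmf M f) A \<le>
      measure_pmf.expectation M (\<lambda>s. indicator C s + indicator N s * p)"
    unfolding prob_bind_pmf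
  proof (rule integral_mono)
    show "integrable (measure_pmf M) (\<lambda>x. measure_pmf.prob (f x) A)"
      by (rule measure_pmf.integrable_const_bound[where B = 1]) auto
    fix s
    show "measure_pmf.prob (f s) A \<le> indicator C s + indicator N s * p"
      using assms(1,2)[of s] assms(3) measure_pmf.prob_le_1[of "f s" A]
      by (cases "s \<in> C"; cases "s \<in> N") (auto intro: order_trans)
  qed (simp add: int)
  also have "\<dots> = measure_pmf.prob M C + measure_pmf.prob M N * p"
    by (simp add: int)
  finally show ?thesis .
qed

text \<open>The final estimate of \<open>fail_0_le\<close>, with \<open>x\<close> the ratio of the
  mean at \<open>M\<close> to \<open>K\<close>. The constant 20326/100000 exceeds 1/4.92, then
  1886/10000 exceeds 3/4 * 20326/100000 + 13/360, and 40 is twice the lower bound 20 for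
  \<open>K\<close>.\<close>

lemma rational_bound_on_unit_interval:
  fixes x :: real
  assumes "1 / 2 \<le> x" "x \<le> 1"
  shows "1886 / 10000 + 20326 / 100000 * (x / (x + 40 * (1 - x)\<^sup>2)) \<le> 4 / 10 * x"
proof -
  have pos: "x + 40 * (1 - x)\<^sup>2 > 0"
    using assms by (simp add: add_pos_nonneg)
  \<comment> \<open>The cubic has a small positive local minimum close to \<open>x = 975/1000\<close>.\<close>
  have "(4 / 10 * x - 1886 / 10000) * (x + 40 * (1 - x)\<^sup>2) - 20326 / 100000 * x =
      (x - 975 / 1000)\<^sup>2 * (16 * x - 7944 / 1000) + (7765 / 1000000 - 466 / 100000 * x)"
    by (simp add: power2_eq_square field_simps)
  also have "\<dots> \<ge> 0"
    using assms by (intro add_nonneg_nonneg mult_nonneg_nonneg) auto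
  finally have "20326 / 100000 * x \<le> (4 / 10 * x - 1886 / 10000) * (x + 40 * (1 - x)\<^sup>2)"
    by simp
  then have "20326 / 100000 * x / (x + 40 * (1 - x)\<^sup>2) \<le> 4 / 10 * x - 1886 / 10000"
    by (subst pos_divide_le_eq[OF pos])
  then show ?thesis by simp
qed

section \<open>Failure probability of a single run\<close>

text \<open>The situation in which the loop is entered, with \<open>K\<close> half the pivot. The
  constant 4.92 = 3 * 1.64 is a lower bound for \<open>3 * exp (1 / 2)\<close>.\<close>

locale hashing_run =
  fixes n :: nat and F :: cnf and B :: solver and \<epsilon> :: real and K l :: nat
  assumes over: "cnf_over n F" and sat: "bounded_sat n B"
    and eps: "0 < \<epsilon>" "\<epsilon> \<le> 1" and K20: "K \<ge> 20"
    and K_large: "492 / 100 \<le> real K * (\<epsilon> / (1 + \<epsilon>))\<^sup>2"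
    and many: "card (cnf_sols n F) > 2 * K"
    and l: "2 ^ l \<le> K"
begin

definition "R = real (card (cnf_sols n F))"

definition "mu m = R / 2 ^ m"

text \<open>The relative deviation allowed below the mean, as
  \<open>1 - \<beta> = 1 / (1 + \<epsilon>)\<close>. Since \<open>\<beta> \<le> \<epsilon>\<close>,
  both ends of the target interval are at least \<open>\<beta> * mu m\<close> away from the
  mean.\<close>

definition "\<beta> = \<epsilon> / (1 + \<epsilon>)"

definition "off_target m = {s. real s < mu m / (1 + \<epsilon>) \<or> (1 + \<epsilon>) * mu m < real s}"

definition "big = {s. s > 2 * K}"

text \<open>The index is the number of constraints with which the loop is entered; the result
  \<open>None\<close> counts as failure.\<close>

definition "fail m = measure_pmf.prob (core_loop B n F (2 * K) l (l + m))
   (- {r. \<exists>c. r = Some c \<and> inverse (1 + \<epsilon>) * R \<le> real c \<and> real c \<le> (1 + \<epsilon>) * R})"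

abbreviation "hprob m \<equiv> measure_pmf.prob (hash_count n F m)"

lemma R_pos: "R > 0" and R_gt: "R > 2 * real K"
  using many by (auto simp: R_def)

lemma mu_eq: "mu m = real (card (cnf_sols n F)) / 2 ^ m"
  by (simp add: mu_def R_def)

lemma mu_pos: "mu m > 0"
  using R_pos by (simp add: mu_def)

lemma beta: "0 < \<beta>" "\<beta> \<le> \<epsilon>" "1 - \<beta> = 1 / (1 + \<epsilon>)"
  using eps by (auto simp: \<beta>_def field_simps)

lemma on_target_pos:
  assumes "s \<notin> off_target m"
  shows "1 \<le> s"
proof -
  have "0 < mu m / (1 + \<epsilon>)" using mu_pos eps by simp
  then show ?thesis using assms by (cases s) (auto simp: off_target_def)
qed

lemma on_target_estimate:
  assumes "s \<notin> off_target m"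
  shows "inverse (1 + \<epsilon>) * R \<le> real (s * 2 ^ m)" "real (s * 2 ^ m) \<le> (1 + \<epsilon>) * R"
proof -
  have e: "R / 2 ^ m / (1 + \<epsilon>) * 2 ^ m = inverse (1 + \<epsilon>) * R"
      "(1 + \<epsilon>) * (R / 2 ^ m) * 2 ^ m = (1 + \<epsilon>) * R"
    by (simp_all add: divide_inverse)
  have "R / 2 ^ m / (1 + \<epsilon>) \<le> real s" "real s \<le> (1 + \<epsilon>) * (R / 2 ^ m)"
    using assms by (auto simp: off_target_def mu_def)
  then have "R / 2 ^ m / (1 + \<epsilon>) * 2 ^ m \<le> real s * 2 ^ m"
      "real s * 2 ^ m \<le> (1 + \<epsilon>) * (R / 2 ^ m) * 2 ^ m"
    by (intro mult_right_mono; simp)+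
  then show "inverse (1 + \<epsilon>) * R \<le> real (s * 2 ^ m)" "real (s * 2 ^ m) \<le> (1 + \<epsilon>) * R"
    unfolding e by simp_all
qed

lemma fail_nonneg: "fail m \<ge> 0"
  by (simp add: fail_def)

text \<open>A count of zero, on which the loop goes on, is off target and charged at once, so only
  counts in \<open>big\<close> lead to \<open>fail (Suc m)\<close>.\<close>

lemma fail_step:
  assumes "l + m < n"
  shows "fail m \<le> hprob m (off_target m - big) + hprob m big * fail (Suc m)"
  unfolding fail_def core_loop_hash_count[OF over sat, of _ _ "l + m"] add_diff_cancel_left'
proof (rule prob_bind_pmf_le_split)
  fix s assume s: "s \<notin> off_target m - big" "s \<notin> big"
  then have "s \<notin> off_target m" "s \<le> 2 * K" by (auto simp: big_def)
  with on_target_pos[of s m] on_target_estimate[of s m] show "measure_pmf.prob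
      (if (1 \<le> s \<and> s \<le> 2 * K) \<or> n \<le> l + m
       then return_pmf (if 2 * K < s \<or> s = 0 then None else Some (s * 2 ^ m))
       else core_loop B n F (2 * K) l (l + m + 1))
      (- {r. \<exists>c. r = Some c \<and> inverse (1 + \<epsilon>) * R \<le> real c \<and> real c \<le> (1 + \<epsilon>) * R}) = 0"
    by (auto simp: measure_return)
qed (use assms in \<open>auto simp: big_def\<close>)

text \<open>Because \<open>\<epsilon> \<le> 1\<close>, on-target counts are here at most
  \<open>2 * K\<close>. The loop stops on them, which leaves no continuation term.\<close>

lemma fail_last:
  assumes "mu m \<le> K"
  shows "fail m \<le> hprob m (off_target m)"
proof -
  have "fail m \<le> hprob m (off_target m) + hprob m {} * 0"
    unfolding fail_def core_loop_hash_count[OF over sat, of _ _ "l + m"] add_diff_cancel_left'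
  proof (rule prob_bind_pmf_le_split)
    fix s assume s: "s \<notin> off_target m"
    then have "real s \<le> (1 + \<epsilon>) * mu m" by (auto simp: off_target_def)
    also have "\<dots> \<le> 2 * real K"
      using eps assms mu_pos[of m] by (intro mult_mono) auto
    finally have "s \<le> 2 * K" by linarith
    with s on_target_pos[of s m] on_target_estimate[of s m] show "measure_pmf.prob
      (if (1 \<le> s \<and> s \<le> 2 * K) \<or> n \<le> l + m
       then return_pmf (if 2 * K < s \<or> s = 0 then None else Some (s * 2 ^ m))
       else core_loop B n F (2 * K) l (l + m + 1))
      (- {r. \<exists>c. r = Some c \<and> inverse (1 + \<epsilon>) * R \<le> real c \<and> real c \<le> (1 + \<epsilon>) * R}) = 0"
      by (auto simp: measure_return)
  qed auto
  then show ?thesis by simp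
qed

lemma hprob_off_target: "hprob m (off_target m) \<le> 1 / (\<beta>\<^sup>2 * mu m)"
proof -
  have "hprob m (off_target m) \<le> mu m / (\<beta> * mu m)\<^sup>2"
  proof (rule hash_count_chebyshev[where \<mu> = "mu m"])
    fix s assume "s \<in> off_target m"
    moreover have "mu m / (1 + \<epsilon>) = mu m - \<beta> * mu m"
      using arg_cong[OF beta(3), of "\<lambda>t. mu m * t"] by (simp add: algebra_simps)
    moreover have "\<beta> * mu m \<le> \<epsilon> * mu m"
      using beta mu_pos[of m] by simp
    ultimately show "\<beta> * mu m \<le> \<bar>real s - mu m\<bar>"
      by (auto simp: off_target_def algebra_simps)
  qed (use beta mu_pos[of m] in \<open>auto intro: mu_eq\<close>)
  also have "\<dots> = 1 / (\<beta>\<^sup>2 * mu m)"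
    using mu_pos[of m] by (simp add: power2_eq_square)
  finally show ?thesis .
qed

lemma hprob_off_target_small:
  "hprob m (off_target m - big) \<le> 1 / (\<beta>\<^sup>2 * mu m)"
  by (rule order_trans[OF measure_pmf.finite_measure_mono hprob_off_target]) auto

text \<open>Far above the pivot, a count of at most \<open>2 * K\<close> already lies below the mean
  by the fraction \<open>c\<close>, which gives a bound free of \<open>\<epsilon>\<close>.\<close>

lemma hprob_not_big:
  assumes "0 < c" "2 * real K \<le> (1 - c) * mu m"
  shows "hprob m (off_target m - big) \<le> 1 / (c\<^sup>2 * mu m)"
proof -
  have "hprob m (off_target m - big) \<le> mu m / (c * mu m)\<^sup>2"
    using assms mu_pos[of m]
    by (intro hash_count_chebyshev[where \<mu> = "mu m"] mu_eq) (auto simp: big_def algebra_simps)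
  also have "\<dots> = 1 / (c\<^sup>2 * mu m)"
    using mu_pos[of m] by (simp add: power2_eq_square)
  finally show ?thesis .
qed

lemma hprob_big:
  assumes "mu m \<le> 2 * real K"
  shows "hprob m big \<le> mu m / (mu m + (2 * K - mu m)\<^sup>2)"
  using assms mu_pos[of m] by (intro hash_count_cantelli[where \<mu> = "mu m"] mu_eq) (auto simp: big_def)


section \<open>The critical number of constraints\<close>

definition M :: nat where "M = (LEAST m. mu m \<le> K)"

text \<open>\<open>R \<le> 2 ^ n\<close> and \<open>2 ^ l \<le> K\<close> bring the mean down to
  \<open>K\<close> by the time \<open>i = n\<close>, so \<open>M\<close> exists and lies within the
  range of the loop.\<close>

lemma mu_last: "mu (n - l) \<le> K" and l_le: "l \<le> n"
proof -
  have "(2::nat) ^ l < 2 ^ n"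
    using l many card_cnf_sols_le[of n F] by linarith
  then show "l \<le> n" by simp
  then have "(2::real) ^ n = 2 ^ l * 2 ^ (n - l)"
    by (simp flip: power_add)
  moreover have "R \<le> 2 ^ n"
    using card_cnf_sols_le[of n F] unfolding R_def by (metis of_nat_le_iff of_nat_numeral of_nat_power)
  ultimately have "mu (n - l) \<le> 2 ^ l"
    by (simp add: mu_def field_simps)
  also have "\<dots> \<le> real K"
    using l by (metis of_nat_le_iff of_nat_numeral of_nat_power)
  finally show "mu (n - l) \<le> K" .
qed

lemma mu_M: "mu M \<le> K"
  unfolding M_def by (rule LeastI, rule mu_last)

lemma l_M: "l + M \<le> n"
proof -
  have "M \<le> n - l" unfolding M_def by (rule Least_le, rule mu_last)
  then show ?thesis using l_le by linarith
qed

text \<open>Since \<open>R > 2 * K\<close>, both \<open>mu 0\<close> and \<open>mu 1\<close> exceed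
  \<open>K\<close>. This makes room for the two levels before \<open>M\<close> that
  \<open>fail_M2\<close> treats.\<close>

lemma M_ge: "M \<ge> 2"
proof (rule ccontr)
  assume "\<not> M \<ge> 2"
  then have "M = 0 \<or> M = 1" by linarith
  then show False
    using mu_M R_gt by (auto simp: mu_def)
qed

lemma mu_M_diff:
  assumes "j \<le> M"
  shows "mu (M - j) = 2 ^ j * mu M"
  using assms by (simp add: mu_def power_diff)

lemma mu_M_gt: "real K < 2 * mu M"
proof -
  have "\<not> mu (M - 1) \<le> K"
    using not_less_Least[of "M - 1" "\<lambda>m. mu m \<le> K"] M_ge by (simp add: M_def)
  then show ?thesis using mu_M_diff[of 1] M_ge by simp
qed

text \<open>The probability of going on is bounded by 1, so the charges of the early levels simply
  add up.\<close>

lemma fail_early_step: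
  assumes "j > 0" "j \<le> M"
  shows "fail (M - j) \<le> hprob (M - j) (off_target (M - j) - big) + fail (M - (j - 1))"
proof -
  have eq: "Suc (M - j) = M - (j - 1)" and "l + (M - j) < n"
    using assms l_M by auto
  then have "fail (M - j) \<le> hprob (M - j) (off_target (M - j) - big) +
      hprob (M - j) big * fail (M - (j - 1))"
    using fail_step[of "M - j"] unfolding eq by blast
  moreover have "hprob (M - j) big * fail (M - (j - 1)) \<le> 1 * fail (M - (j - 1))"
    by (intro mult_right_mono) (auto simp: fail_nonneg)
  ultimately show ?thesis by linarith
qed

text \<open>The levels \<open>M - 2\<close>, \<open>M - 1\<close> and \<open>M\<close> are charged
  \<open>1 / (4 * ?b)\<close>, \<open>1 / (2 * ?b)\<close> and \<open>1 / ?b\<close>. The last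
  charge is weighted by the Cantelli bound for exceeding \<open>2 * K\<close> at
  \<open>M - 1\<close>.\<close>

lemma fail_M2:
  "fail (M - 2) \<le> (3 / 4 + mu M / (mu M + 2 * (K - mu M)\<^sup>2)) / (\<beta>\<^sup>2 * mu M)"
proof -
  let ?b = "\<beta>\<^sup>2 * mu M" and ?P = "mu M / (mu M + 2 * (K - mu M)\<^sup>2)"
  have pos: "?b > 0" using beta mu_pos by simp
  have sum: "1 / (4 * b) + (1 / (2 * b) + P * (1 / b)) = (3 / 4 + P) / b" if "b > 0" for b P :: real
    using that by (simp add: field_simps)
  have f0: "fail M \<le> 1 / ?b"
    using fail_last[OF mu_M] hprob_off_target[of M] by linarith
  have mu1: "mu (M - 1) = 2 * mu M" and mu2: "mu (M - 2) = 4 * mu M"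
    using mu_M_diff[of 1] mu_M_diff[of 2] M_ge by simp_all
  have small1: "hprob (M - 1) (off_target (M - 1) - big) \<le> 1 / (2 * ?b)"
    using hprob_off_target_small[of "M - 1"] unfolding mu1 by (simp add: mult_ac)
  have small2: "hprob (M - 2) (off_target (M - 2) - big) \<le> 1 / (4 * ?b)"
    using hprob_off_target_small[of "M - 2"] unfolding mu2 by (simp add: mult_ac)
  have "hprob (M - 1) big \<le> 2 * mu M / (2 * mu M + (2 * K - 2 * mu M)\<^sup>2)"
    using hprob_big[of "M - 1"] mu_M unfolding mu1 by simp
  also have "2 * mu M + (2 * K - 2 * mu M)\<^sup>2 = 2 * (mu M + 2 * (K - mu M)\<^sup>2)"
    by (simp add: power2_eq_square algebra_simps)
  also have "2 * mu M / (2 * (mu M + 2 * (K - mu M)\<^sup>2)) = ?P"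
    by (rule mult_divide_mult_cancel_left) simp
  finally have big: "hprob (M - 1) big \<le> ?P" .
  have "fail (M - 1) \<le> hprob (M - 1) (off_target (M - 1) - big) + hprob (M - 1) big * fail M"
    using fail_step[of "M - 1"] M_ge l_M by simp
  also have "\<dots> \<le> 1 / (2 * ?b) + ?P * (1 / ?b)"
    using small1 f0 big mu_pos[of M]
    by (intro add_mono mult_mono) (auto simp: fail_nonneg)
  finally have f1: "fail (M - 1) \<le> 1 / (2 * ?b) + ?P * (1 / ?b)" .
  have "fail (M - 2) \<le> hprob (M - 2) (off_target (M - 2) - big) + fail (M - 1)"
    using fail_early_step[of 2] M_ge by simp
  also have "\<dots> \<le> 1 / (4 * ?b) + (1 / (2 * ?b) + ?P * (1 / ?b))"
    by (intro add_mono small2 f1)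
  also have "\<dots> = (3 / 4 + ?P) / ?b"
    using sum[OF pos] .
  finally show ?thesis .
qed

text \<open>In units of \<open>1 / mu M\<close>, level \<open>M - 3\<close> costs at most 1/2 and
  level \<open>M - i\<close> with \<open>i \<ge> 4\<close> at most \<open>16 / 9 / 2 ^ i\<close>.
  Down to level \<open>M - j\<close> this sums to \<open>1 / 2 + 2 / 9 - 16 / 9 / 2 ^ j\<close>, and
  1/2 + 2/9 = 13/18.\<close>

lemma fail_early:
  assumes "2 \<le> j" "j \<le> M"
  shows "fail (M - j) \<le> fail (M - 2) + (if j = 2 then 0 else (13 / 18 - 16 / 9 / 2 ^ j) / mu M)"
  using assms
proof (induction j rule: dec_induct)
  case base
  then show ?case by simp
next
  case (step j)
  have mu: "mu (M - Suc j) = 2 ^ Suc j * mu M"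
    using mu_M_diff[of "Suc j"] step by simp
  have IH: "fail (M - Suc j) \<le> hprob (M - Suc j) (off_target (M - Suc j) - big) + fail (M - 2) +
      (if j = 2 then 0 else (13 / 18 - 16 / 9 / 2 ^ j) / mu M)"
    using fail_early_step[of "Suc j"] step by simp
  show ?case
  proof (cases "j = 2")
    case True
    \<comment> \<open>At \<open>M - 3\<close> the mean exceeds \<open>4 * K\<close>, which admits
      \<open>c = 1 / 2\<close>.\<close>
    have "hprob (M - Suc j) (off_target (M - Suc j) - big) \<le> 1 / ((1 / 2)\<^sup>2 * mu (M - Suc j))"
      using mu_M_gt True mu by (intro hprob_not_big) auto
    also have "\<dots> = (13 / 18 - 16 / 9 / 2 ^ Suc j) / mu M"
      unfolding mu using True by (simp add: power2_eq_square)
    finally show ?thesis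
      using IH True by simp
  next
    case False
    then have "(2::real) ^ 4 \<le> 2 ^ Suc j"
      using step by (intro power_increasing) auto
    then have "(16::real) \<le> 2 ^ Suc j"
      by simp
    then have "16 * mu M \<le> 2 ^ Suc j * mu M"
      using mu_pos[of M] by (intro mult_right_mono) (auto intro: less_imp_le)
    then have "8 * real K \<le> mu (M - Suc j)"
      using mu_M_gt unfolding mu by linarith
    \<comment> \<open>Now \<open>2 * K\<close> is at most a quarter of the mean, which admits
      \<open>c = 3 / 4\<close>.\<close>
    then have "hprob (M - Suc j) (off_target (M - Suc j) - big) \<le> 1 / ((3 / 4)\<^sup>2 * mu (M - Suc j))"
      by (intro hprob_not_big) auto
    also have "\<dots> = 16 / 9 / 2 ^ Suc j / mu M"
      by (simp add: mu power2_eq_square)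
    finally have "hprob (M - Suc j) (off_target (M - Suc j) - big) \<le> 16 / 9 / 2 ^ Suc j / mu M" .
    moreover have "16 / 9 / 2 ^ Suc j / mu M + (13 / 18 - 16 / 9 / 2 ^ j) / mu M =
       (13 / 18 - 16 / 9 / 2 ^ Suc j) / mu M"
      using mu_pos[of M] by (simp add: field_simps)
    ultimately show ?thesis
      using IH False step(1) by auto
  qed
qed

lemma fail_0_le: "fail 0 \<le> 4 / 10"
proof -
  define x where "x = mu M / K"
  have K: "real K \<ge> 20" using K20 by simp
  have mu: "mu M = x * K" using K by (simp add: x_def)
  have x: "1 / 2 \<le> x" "x \<le> 1"
    using mu_M mu_M_gt K by (auto simp: x_def field_simps)
  define P where "P = x / (x + 40 * (1 - x)\<^sup>2)"
  define b where "b = K * \<beta>\<^sup>2"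
  have b: "492 / 100 \<le> b" using K_large by (simp add: b_def \<beta>_def)
  have "fail 0 \<le> fail (M - 2) + (if M = 2 then 0 else (13 / 18 - 16 / 9 / 2 ^ M) / mu M)"
    using fail_early[of M] M_ge by simp
  also have "(if M = 2 then 0 else (13 / 18 - 16 / 9 / 2 ^ M) / mu M) \<le> 13 / 18 / mu M"
    using mu_pos[of M] by (cases "M = 2") (auto simp: diff_divide_distrib intro: less_imp_le)
  finally have "fail 0 \<le> fail (M - 2) + 13 / 18 / mu M" by simp
  \<comment> \<open>Here \<open>mu M = x * K\<close> with \<open>K \<ge> 20\<close>, and 18 * 20 =
    360.\<close>
  also have "13 / 18 / mu M \<le> 13 / 360 / x"
    using x K by (simp add: mu field_simps)
  also have "fail (M - 2) \<le> (3 / 4 + mu M / (mu M + 2 * (K - mu M)\<^sup>2)) / (\<beta>\<^sup>2 * mu M)"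
    by (rule fail_M2)
  also have "\<beta>\<^sup>2 * mu M = b * x" by (simp add: b_def mu)
  also have "mu M / (mu M + 2 * (K - mu M)\<^sup>2) = x / (x + 2 * K * (1 - x)\<^sup>2)"
  proof -
    have "mu M + 2 * (K - mu M)\<^sup>2 = K * (x + 2 * K * (1 - x)\<^sup>2)"
      by (simp add: mu power2_eq_square algebra_simps)
    then show ?thesis using K by (simp add: mu)
  qed
  \<comment> \<open>The factor \<open>2 * K\<close> is lowered to 40.\<close>
  also have "\<dots> \<le> x / (x + 40 * (1 - x)\<^sup>2)"
    using x K by (intro divide_left_mono add_left_mono mult_right_mono mult_pos_pos)
      (auto intro!: add_pos_nonneg)
  finally have "fail 0 \<le> (3 / 4 + P) / (b * x) + 13 / 360 / x"
    using x b by (simp add: divide_right_mono P_def)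
  also have "\<dots> = ((3 / 4 + P) * (1 / b) + 13 / 360) / x"
    using x b by (simp add: field_simps)
  also have "\<dots> \<le> (4 / 10 * x) / x"
  proof (intro divide_right_mono)
    have "1 / b \<le> 20326 / 100000" using b by (simp add: field_simps)
    then have "(3 / 4 + P) * (1 / b) \<le> (3 / 4 + P) * (20326 / 100000)"
      using x by (intro mult_left_mono) (auto simp: P_def)
    moreover have "1886 / 10000 + 20326 / 100000 * P \<le> 4 / 10 * x"
      unfolding P_def by (rule rational_bound_on_unit_interval[OF x])
    ultimately show "(3 / 4 + P) * (1 / b) + 13 / 360 \<le> 4 / 10 * x"
      unfolding distrib_right by linarith
  qed (use x in auto)
  also have "\<dots> = 4 / 10" using x by simp
  finally show ?thesis .
qed

end

section \<open>Bounds for the pivot and the initial value of the loop counter\<close>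

lemma exp_half_gt: "164 / 100 < exp (1 / 2 :: real)"
proof -
  have "(exp (1 / 2 :: real))\<^sup>2 = exp 1"
    by (simp flip: exp_double)
  \<comment> \<open>The square of 1.64 is 2.6896, below e.\<close>
  also have "\<dots> > (164 / 100)\<^sup>2"
    using e_approx_32 by (simp add: abs_if power2_eq_square split: if_splits)
  finally show ?thesis
    by (rule power_less_imp_less_base) simp
qed

text \<open>\<open>1 + 1 / \<epsilon>\<close> is the reciprocal of
  \<open>\<epsilon> / (1 + \<epsilon>)\<close>, so the squares cancel and leave
  \<open>3 * exp (1 / 2)\<close>, which exceeds 4.92.\<close>

lemma approxmc_pivot_half:
  assumes "0 < \<epsilon>" "\<epsilon> \<le> 1"
  obtains K where "approxmc_pivot \<epsilon> = 2 * K" "K \<ge> 20" "492 / 100 \<le> real K * (\<epsilon> / (1 + \<epsilon>))\<^sup>2"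
proof
  define K where "K = nat \<lceil>3 * exp (1 / 2) * (1 + 1 / \<epsilon>)\<^sup>2\<rceil>"
  show "approxmc_pivot \<epsilon> = 2 * K" by (simp add: approxmc_pivot_def K_def)
  have K: "3 * exp (1 / 2) * (1 + 1 / \<epsilon>)\<^sup>2 \<le> real K"
    unfolding K_def by (rule real_nat_ceiling_ge)
  have "(2::real)\<^sup>2 \<le> (1 + 1 / \<epsilon>)\<^sup>2"
    using assms by (intro power_mono) (auto simp: field_simps)
  \<comment> \<open>The left side is 19.68, so the integer \<open>K\<close> exceeds 19.\<close>
  then have "3 * (164 / 100) * 4 \<le> 3 * exp (1 / 2) * (1 + 1 / \<epsilon>)\<^sup>2"
    using exp_half_gt by (intro mult_mono) auto
  then have "real K > 19" using K by linarith
  then show "K \<ge> 20" by linarith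
  have "1 + 1 / \<epsilon> = (1 + \<epsilon>) / \<epsilon>"
    using assms by (simp add: field_simps)
  then have "(1 + 1 / \<epsilon>) * (\<epsilon> / (1 + \<epsilon>)) = (1 + \<epsilon>) / \<epsilon> * (\<epsilon> / (1 + \<epsilon>))"
    by (simp only:)
  also have "\<dots> = 1"
    using assms by simp
  finally have "(1 + 1 / \<epsilon>) * (\<epsilon> / (1 + \<epsilon>)) = 1" .
  then have one: "(1 + 1 / \<epsilon>)\<^sup>2 * (\<epsilon> / (1 + \<epsilon>))\<^sup>2 = 1"
    by (simp only: power_mult_distrib[symmetric] power_one)
  have "492 / 100 \<le> 3 * exp (1 / 2 :: real)" using exp_half_gt by simp
  also have "\<dots> = 3 * exp (1 / 2) * ((1 + 1 / \<epsilon>)\<^sup>2 * (\<epsilon> / (1 + \<epsilon>))\<^sup>2)"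
    by (simp only: one mult_1_right)
  also have "\<dots> = 3 * exp (1 / 2) * (1 + 1 / \<epsilon>)\<^sup>2 * (\<epsilon> / (1 + \<epsilon>))\<^sup>2"
    by (simp only: mult.assoc)
  also have "\<dots> \<le> real K * (\<epsilon> / (1 + \<epsilon>))\<^sup>2"
    using K by (intro mult_right_mono) auto
  finally show "492 / 100 \<le> real K * (\<epsilon> / (1 + \<epsilon>))\<^sup>2" .
qed

text \<open>Halving the pivot lowers its binary logarithm by 1, so the exponent is the floor of
  \<open>log 2 (real K)\<close>. This is nonnegative, so \<open>nat\<close> truncates
  nothing.\<close>

lemma power_floor_log_le:
  assumes "K > 0"
  shows "2 ^ nat (\<lfloor>log 2 (real (2 * K))\<rfloor> - 1) \<le> K"
proof -
  have log: "log 2 (real (2 * K)) = 1 + log 2 (real K)"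
    using assms by (simp add: log_mult)
  have "log 2 (real K) \<ge> 0" using assms by simp
  then have "real (nat (\<lfloor>log 2 (real (2 * K))\<rfloor> - 1)) \<le> log 2 (real K)"
    unfolding log by simp
  then have "2 powr real (nat (\<lfloor>log 2 (real (2 * K))\<rfloor> - 1)) \<le> real K"
    using assms by (simp add: le_log_iff)
  then have "real (2 ^ nat (\<lfloor>log 2 (real (2 * K))\<rfloor> - 1)) \<le> real K"
    by (simp add: powr_realpow)
  then show ?thesis by (simp only: of_nat_le_iff)
qed

text \<open>Either the first solver call already yields the exact count, which is on target, or the
  loop is entered with no constraints and \<open>fail 0\<close> is the failure probability.\<close>

lemma approxmc_core_fail:
  assumes "cnf_over n F" "bounded_sat n B" "0 < \<epsilon>" "\<epsilon> \<le> 1"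
  defines "R \<equiv> real (card (cnf_sols n F))"
  shows "measure_pmf.prob (approxmc_core B n F (approxmc_pivot \<epsilon>))
     (- {r. \<exists>c. r = Some c \<and> inverse (1 + \<epsilon>) * R \<le> real c \<and> real c \<le> (1 + \<epsilon>) * R}) \<le> 4 / 10"
proof -
  obtain K where K: "approxmc_pivot \<epsilon> = 2 * K" "K \<ge> 20" "492 / 100 \<le> real K * (\<epsilon> / (1 + \<epsilon>))\<^sup>2"
    using approxmc_pivot_half[OF assms(3,4)] .
  have "sols n (CnfXor F []) = cnf_sols n F" by (simp add: cnf_sols_def)
  then have card: "card (B (CnfXor F []) v) = min v (card (cnf_sols n F))" for v
    using assms(1,2) by (simp add: bounded_sat_def)
  show ?thesis
  proof (cases "card (cnf_sols n F) \<le> 2 * K")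
    case True
    then have "approxmc_core B n F (2 * K) = return_pmf (Some (card (cnf_sols n F)))"
      by (simp add: approxmc_core_def card)
    moreover have "inverse (1 + \<epsilon>) * R \<le> R" "R \<le> (1 + \<epsilon>) * R"
      using assms(3) by (auto simp: R_def field_simps)
    ultimately show ?thesis
      by (simp add: K(1) measure_return R_def)
  next
    case False
    define l where "l = nat (\<lfloor>log 2 (real (2 * K))\<rfloor> - 1)"
    have "2 ^ l \<le> K"
      unfolding l_def using K by (intro power_floor_log_le) auto
    then interpret run: hashing_run n F B \<epsilon> K l
      using assms(1-4) K False by unfold_locales auto
    have "approxmc_core B n F (2 * K) = core_loop B n F (2 * K) l l"
      using False by (simp add: approxmc_core_def card l_def Let_def)
    then show ?thesis
      using run.fail_0_le by (simp add: run.fail_def run.R_def R_def K(1))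
  qed
qed

section \<open>Amplification by the median\<close>

text \<open>If entry \<open>p\<close> is below \<open>a\<close>, so are all entries before it; if it
  is above \<open>b\<close>, so are all after it. Either way at least half the entries are outside,
  since the conditions on \<open>p\<close> single out the middle positions, two of them for even
  length.\<close>

lemma sorted_nth_in_interval:
  fixes ys :: "'a :: linorder list"
  assumes "sorted ys" "2 * length (filter (\<lambda>y. \<not> (a \<le> y \<and> y \<le> b)) ys) < length ys"
    and p: "p < length ys" "length ys \<le> 2 * (p + 1)" "2 * p \<le> length ys"
  shows "a \<le> ys ! p \<and> ys ! p \<le> b"
proof (rule ccontr)
  let ?I = "{i. i < length ys \<and> \<not> (a \<le> ys ! i \<and> ys ! i \<le> b)}"
  assume "\<not> ?thesis"
  then consider "ys ! p < a" | "b < ys ! p" by force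
  then have "length ys \<le> 2 * card ?I"
  proof cases
    case 1
    have "{..p} \<subseteq> ?I"
    proof
      fix i assume "i \<in> {..p}"
      then have "ys ! i \<le> ys ! p" using assms by (intro sorted_nth_mono) auto
      then show "i \<in> ?I" using 1 p \<open>i \<in> {..p}\<close> by auto
    qed
    then have "card {..p} \<le> card ?I" by (intro card_mono) auto
    then show ?thesis using p by simp
  next
    case 2
    have "{p..<length ys} \<subseteq> ?I"
    proof
      fix i assume "i \<in> {p..<length ys}"
      then have "ys ! p \<le> ys ! i" using assms by (intro sorted_nth_mono) auto
      then show "i \<in> ?I" using 2 \<open>i \<in> {p..<length ys}\<close> by auto
    qed
    then have "card {p..<length ys} \<le> card ?I" by (intro card_mono) auto
    then show ?thesis using p by simp
  qed
  then show False
    using assms(2) by (simp add: length_filter_conv_card)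
qed

lemma median_in_interval:
  assumes "2 * length (filter (\<lambda>x. \<not> (a \<le> x \<and> x \<le> b)) xs) < length xs"
  shows "a \<le> median xs \<and> median xs \<le> b"
proof -
  define ys where "ys = sort xs"
  have len: "length ys = length xs" by (simp add: ys_def)
  have "length (filter (\<lambda>x. \<not> (a \<le> x \<and> x \<le> b)) ys) = length (filter (\<lambda>x. \<not> (a \<le> x \<and> x \<le> b)) xs)"
    unfolding ys_def filter_sort by simp
  then have nth: "a \<le> ys ! p \<and> ys ! p \<le> b"
    if "p < length ys" "length ys \<le> 2 * (p + 1)" "2 * p \<le> length ys" for p
    using assms that len by (intro sorted_nth_in_interval) (auto simp: ys_def)
  have pos: "length ys > 0" using assms len by linarith
  show ?thesis
  proof (cases "odd (length ys)")
    case True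
    then have "a \<le> ys ! (length ys div 2) \<and> ys ! (length ys div 2) \<le> b"
      by (intro nth) (auto elim!: oddE)
    then show ?thesis using True by (simp add: median_def ys_def Let_def)
  next
    case False
    \<comment> \<open>This keeps the subtraction in \<open>length ys div 2 - 1\<close> from being
      truncated at zero.\<close>
    then have "length ys \<ge> 2" using pos by presburger
    with False have "a \<le> ys ! (length ys div 2) \<and> ys ! (length ys div 2) \<le> b"
        "a \<le> ys ! (length ys div 2 - 1) \<and> ys ! (length ys div 2 - 1) \<le> b"
      by (intro nth; presburger)+
    then show ?thesis using False by (simp add: median_def ys_def Let_def)
  qed
qed

text \<open>Every \<open>None\<close> counts as a bad result. Removing \<open>k\<close> of them
  lowers the length by \<open>k\<close> but twice the number of bad results by \<open>2 * k\<close>,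
  so the good ones keep their strict majority.\<close>

lemma median_non_bot_in_interval:
  assumes "2 * length (filter (\<lambda>r. \<not> (\<exists>c. r = Some c \<and> a \<le> real c \<and> real c \<le> b)) rs) < length rs"
  shows "\<exists>c. median_non_bot rs = Some c \<and> a \<le> c \<and> c \<le> b"
proof -
  define cs where "cs = map (\<lambda>r. real (the r)) (filter (\<lambda>r. r \<noteq> None) rs)"
  define k where "k = length (filter (\<lambda>r. r = None) rs)"
  have "length rs = k + length cs"
    unfolding cs_def k_def by (induction rs) auto
  moreover have "length (filter (\<lambda>r. \<not> (\<exists>c. r = Some c \<and> a \<le> real c \<and> real c \<le> b)) rs) =
      k + length (filter (\<lambda>x. \<not> (a \<le> x \<and> x \<le> b)) cs)"
    unfolding cs_def k_def by (induction rs) auto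
  ultimately have less: "2 * length (filter (\<lambda>x. \<not> (a \<le> x \<and> x \<le> b)) cs) < length cs"
    using assms by linarith
  then have "cs \<noteq> []" by auto
  then show ?thesis
    using median_in_interval[OF less] by (simp add: median_non_bot_def cs_def Let_def)
qed

lemma map_replicate_pmf: "map_pmf (map g) (replicate_pmf t p) = replicate_pmf t (map_pmf g p)"
proof (induction t)
  case (Suc t)
  have "map_pmf (map g) (replicate_pmf (Suc t) p) =
      p \<bind> (\<lambda>x. map_pmf (map g) (replicate_pmf t p) \<bind> (\<lambda>xs. return_pmf (g x # xs)))"
    by (simp add: map_bind_pmf bind_map_pmf)
  then show ?case
    by (simp add: Suc.IH bind_map_pmf)
qed simp

lemma map_pmf_pred_bernoulli:
  "map_pmf Q p = bernoulli_pmf (measure_pmf.prob p {x. Q x})"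
proof (rule pmf_eqI)
  fix b
  have "pmf (map_pmf Q p) True = measure_pmf.prob p {x. Q x}"
    by (simp add: pmf_map vimage_def)
  moreover have "pmf (map_pmf Q p) False = 1 - measure_pmf.prob p {x. Q x}"
    using measure_pmf.prob_compl[of "{x. Q x}" p] by (simp add: pmf_map vimage_def Compl_eq_Diff_UNIV[symmetric] Collect_neg_eq)
  ultimately show "pmf (map_pmf Q p) b = pmf (bernoulli_pmf (measure_pmf.prob p {x. Q x})) b"
    by (cases b) auto
qed

text \<open>Makes the number of failing runs binomial, so that Hoeffding's inequality applies to
  it.\<close>

lemma map_count_replicate_pmf:
  "map_pmf (\<lambda>rs. length (filter Q rs)) (replicate_pmf t p) =
     binomial_pmf t (measure_pmf.prob p {x. Q x})"
proof -
  have "(\<lambda>rs. length (filter Q rs)) = (length \<circ> filter id) \<circ> map Q"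
    by (auto simp: fun_eq_iff filter_map)
  then have "map_pmf (\<lambda>rs. length (filter Q rs)) (replicate_pmf t p) =
      map_pmf (length \<circ> filter id) (map_pmf (map Q) (replicate_pmf t p))"
    by (simp add: pmf.map_comp)
  then show ?thesis
    by (simp add: map_replicate_pmf map_pmf_pred_bernoulli binomial_pmf_altdef)
qed

lemma prob_half_fail:
  assumes "t > 0" "measure_pmf.prob p {x. Q x} \<le> 4 / 10"
  shows "measure_pmf.prob (replicate_pmf t p) {rs. t \<le> 2 * length (filter Q rs)} \<le> exp (- real t / 50)"
proof -
  define f where "f = measure_pmf.prob p {x. Q x}"
  interpret binomial_distribution t f
    by unfold_locales (simp add: f_def)
  \<comment> \<open>The gap between half the runs and the expected number of failures; it is at
    least \<open>t / 10\<close>, so Hoeffding's exponent \<open>2 * e\<^sup>2 / t\<close> is at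
    least \<open>t / 50\<close>.\<close>
  define e where "e = real t / 2 - real t * f"
  have "real t * f \<le> real t * (4 / 10)"
    using assms(2) by (intro mult_left_mono) (auto simp: f_def)
  then have e: "real t / 10 \<le> e" unfolding e_def by linarith
  have "measure_pmf.prob (replicate_pmf t p) {rs. t \<le> 2 * length (filter Q rs)} =
     measure_pmf.prob (map_pmf (\<lambda>rs. length (filter Q rs)) (replicate_pmf t p)) {k. t \<le> 2 * k}"
    by (simp add: vimage_def)
  also have "\<dots> = measure_pmf.prob (binomial_pmf t f) {k. real k \<ge> real t * f + e}"
    unfolding map_count_replicate_pmf f_def[symmetric]
    by (intro arg_cong[where f = "measure_pmf.prob _"]) (auto simp: e_def)
  also have "\<dots> \<le> exp (- 2 * e\<^sup>2 / real t)"
    using e by (intro prob_ge assms) simp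
  also have "\<dots> \<le> exp (- real t / 50)"
  proof -
    have "(real t / 10)\<^sup>2 \<le> e\<^sup>2" using e by (intro power_mono) auto
    then show ?thesis
      using assms(1) by (simp add: field_simps power2_eq_square)
  qed
  finally show ?thesis .
qed

text \<open>As \<open>ln 2 \<le> 7 / 10\<close>, the factor 35 for the binary logarithm is worth at
  least 50 for the natural one. This even gives the bound \<open>\<delta> / 3\<close>.\<close>

lemma approxmc_reps_bound:
  assumes "0 < \<delta>" "\<delta> \<le> 1"
  shows "approxmc_reps \<delta> > 0" "exp (- real (approxmc_reps \<delta>) / 50) \<le> \<delta>"
proof -
  define L where "L = ln (3 / \<delta>)"
  have L: "L > 0" unfolding L_def using assms by (intro ln_gt_zero) (simp add: field_simps)
  have ln2: "0 < ln (2::real)" "ln (2::real) \<le> 7 / 10"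
    using ln2_le_25_over_36 by auto
  have t: "35 * (L / ln 2) \<le> real (approxmc_reps \<delta>)"
    unfolding approxmc_reps_def L_def log_def[symmetric] by (rule real_nat_ceiling_ge)
  have "10 / 7 * L \<le> L / ln 2"
    using L ln2 by (simp add: field_simps)
  then have t': "50 * L \<le> real (approxmc_reps \<delta>)"
    using t by linarith
  then show "approxmc_reps \<delta> > 0" using L by (cases "approxmc_reps \<delta>") auto
  have "exp (- real (approxmc_reps \<delta>) / 50) \<le> exp (- L)" using t' by simp
  also have "\<dots> = \<delta> / 3" unfolding L_def using assms by (simp add: exp_minus)
  also have "\<dots> \<le> \<delta>" using assms by simp
  finally show "exp (- real (approxmc_reps \<delta>) / 50) \<le> \<delta>" .
qed

theorem theorem3:
  fixes n :: nat and F :: cnf and B :: solver and \<epsilon> \<delta> :: real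
  assumes "cnf_over n F"
    and "bounded_sat n B"
    and "0 < \<epsilon>" and "\<epsilon> \<le> 1"
    and "0 < \<delta>" and "\<delta> \<le> 1"
  shows "measure_pmf.prob (approxmc B n F \<epsilon> \<delta>)
           {r. \<exists>c. r = Some c \<and>
                 inverse (1 + \<epsilon>) * real (card (cnf_sols n F)) \<le> c \<and>
                 c \<le> (1 + \<epsilon>) * real (card (cnf_sols n F))}
         \<ge> 1 - \<delta>"
proof -
  define R where "R = real (card (cnf_sols n F))"
  define Q where "Q = (\<lambda>r. \<not> (\<exists>c. r = Some c \<and> inverse (1 + \<epsilon>) * R \<le> real c \<and> real c \<le> (1 + \<epsilon>) * R))"
  define t where "t = approxmc_reps \<delta>"
  define p where "p = approxmc_core B n F (approxmc_pivot \<epsilon>)"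
  define G where "G = {r. \<exists>c. r = Some c \<and> inverse (1 + \<epsilon>) * R \<le> c \<and> c \<le> (1 + \<epsilon>) * R}"
  define H where "H = {rs. t \<le> 2 * length (filter Q rs)}"
  have "measure_pmf.prob p {r. Q r} \<le> 4 / 10"
    using approxmc_core_fail[OF assms(1-4)] unfolding Q_def p_def R_def Collect_neg_eq .
  then have "measure_pmf.prob (replicate_pmf t p) H \<le> exp (- real t / 50)"
    unfolding H_def using approxmc_reps_bound[OF assms(5,6)] by (intro prob_half_fail) (auto simp: t_def)
  also have "\<dots> \<le> \<delta>"
    using approxmc_reps_bound[OF assms(5,6)] by (simp add: t_def)
  finally have "1 - \<delta> \<le> measure_pmf.prob (replicate_pmf t p) (- H)"
    using measure_pmf.prob_compl[of H "replicate_pmf t p"] by (simp add: Compl_eq_Diff_UNIV)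
  also have "\<dots> \<le> measure_pmf.prob (replicate_pmf t p) (median_non_bot -` G)"
  proof (rule measure_pmf.finite_measure_mono_AE)
    \<comment> \<open>The inclusion relies on \<open>length rs = t\<close>, which is known only on
      the support.\<close>
    show "AE rs in replicate_pmf t p. rs \<in> - H \<longrightarrow> rs \<in> median_non_bot -` G"
      unfolding AE_measure_pmf_iff
    proof (intro ballI impI)
      fix rs assume "rs \<in> set_pmf (replicate_pmf t p)" "rs \<in> - H"
      then have "2 * length (filter Q rs) < length rs"
        by (auto simp: set_replicate_pmf H_def)
      then show "rs \<in> median_non_bot -` G"
        unfolding Q_def G_def by (simp add: median_non_bot_in_interval)
    qed
  qed simp
  finally show ?thesis
    by (simp add: approxmc_def G_def R_def t_def p_def)
qed

end
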